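(* Let $G$ be a finite simple connected graph with $n$ vertices $v_1,\dots,v_n$ that is not a tree, with sink $s=v_n$. Let $\overline{\Delta}$ and $\Delta$ be its full and reduced Laplacians, and let $\gamma_c$ and $\gamma_d$ be the spectral gaps of the continuous time and discrete time sandpile chains on $G$. Then $$8\,\frac{\|y\|_2^2}{n}\le \gamma_c\le 2\pi^2\,\frac{\|y\|_2^2}{n},$$ where $y$ is a vector of minimal Euclidean length in $(\Delta^{-1}\mathbb{Z}^{n-1})\setminus\mathbb{Z}^{n-1}$, and $$8\,\frac{\|z\|_2^2}{n}\le \gamma_d\le 2\pi^2\,\frac{\|z\|_2^2}{n},$$ where $z$ is a vector of minimal Euclidean length in $(\overline{\Delta}^{+}\mathbb{Z}_0^n)\setminus\mathbb{W}^n$.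
   Context: The full Laplacian $\overline{\Delta}$ of $G$ is the $n\times n$ matrix with $\overline{\Delta}(i,i)=\deg(v_i)$, $\overline{\Delta}(i,j)=-1$ if $v_i\sim v_j$, and $0$ otherwise. The reduced Laplacian $\Delta$ is the $(n-1)\times(n-1)$ submatrix of $\overline{\Delta}$ obtained by deleting the last row and column (corresponding to the sink); it is invertible. $\overline{\Delta}^+$ is the Moore-Penrose pseudoinverse of $\overline{\Delta}$. $\mathbb{R}_0^n$ is the subspace of vectors in $\mathbb{R}^n$ whose coordinates sum to zero; $\mathbb{Z}_0^n=\mathbb{Z}^n\cap\mathbb{R}_0^n$; $\mathbb{W}^n$ is the orthogonal projection of $\mathbb{Z}^n$ onto $\mathbb{R}_0^n$. A multiplicative harmonic function on $G$ (with sink $s$) is a function $h:V\to\mathbb{C}^*$ with $h(s)=1$ and $h(v)^{\deg(v)}=\prod_{w\sim v}h(w)$ for all $v\in V$; such functions automatically take values of modulus $1$. $\mathcal{H}$ is the (finite) set of all of them. For $h\in\mathcal{H}$ put $\lambda_h=\frac1n\sum_{v\in V}h(v)$; these are the eigenvalues of the sandpile chain. The spectral gaps are defined by $$\gamma_c=\min\{1-\mathrm{Re}(\lambda_h): h\in\mathcal{H},\,h\not\equiv1\},\qquad \gamma_d=\min\{1-|\lambda_h|: h\in\mathcal{H},\,h\not\equiv1\}.$$ *)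

theory Defs
  imports
    Complex_Main
    "HOL-Library.FuncSet"
    "HOL-Analysis.L2_Norm"
    "Graph_Theory.Graph_Theory"
    "Jordan_Normal_Form.Determinant"
    "Jordan_Normal_Form.Gauss_Jordan_Elimination"
begin

text \<open>
  Simple graphs are those of the locale \<^locale>\<open>pair_graph\<close>: finite, loopless, and every undirected
  edge is represented by its two arcs, so \<^const>\<open>out_degree\<close> is the usual degree. The library's
  notion of a tree excludes the closed walk u, v, u along a single edge and is therefore not
  the undirected one; undirected cycles have length at least 3.
\<close>

definition undirected_tree :: "'a pair_pre_digraph \<Rightarrow> bool" where
  "undirected_tree G \<longleftrightarrow>
     Digraph_Component.connected (with_proj G) \<and>
     \<not> (\<exists>p. pre_digraph.cycle (with_proj G) p \<and> 3 \<le> length p)"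

text \<open>The vertices $v_1, \dots, v_n$ are given by a list, so $v_i$ is entry $i - 1$; the sink is its last entry.\<close>

definition full_laplacian :: "'a pair_pre_digraph \<Rightarrow> 'a list \<Rightarrow> real mat" where
  "full_laplacian G vs = Matrix.mat (length vs) (length vs)
     (\<lambda>(i, j). if i = j then real (out_degree (with_proj G) (vs ! i))
               else if (vs ! i, vs ! j) \<in> parcs G then - 1
               else 0)"

definition reduced_laplacian :: "'a pair_pre_digraph \<Rightarrow> 'a list \<Rightarrow> real mat" where
  "reduced_laplacian G vs =
     mat_delete (full_laplacian G vs) (length vs - 1) (length vs - 1)"

definition is_moore_penrose :: "real mat \<Rightarrow> real mat \<Rightarrow> bool" where
  "is_moore_penrose A B \<longleftrightarrow>
     B \<in> carrier_mat (dim_col A) (dim_row A) \<and>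
     A * B * A = A \<and> B * A * B = B \<and>
     transpose_mat (A * B) = A * B \<and> transpose_mat (B * A) = B * A"

definition moore_penrose :: "real mat \<Rightarrow> real mat" where
  "moore_penrose A = (THE B. is_moore_penrose A B)"

definition vec_l2 :: "real Matrix.vec \<Rightarrow> real" where
  "vec_l2 x = L2_set (vec_index x) {..<dim_vec x}"

definition int_vecs :: "nat \<Rightarrow> real Matrix.vec set" where
  "int_vecs n = {x \<in> carrier_vec n. \<forall>i<n. vec_index x i \<in> \<int>}"

definition real0_vecs :: "nat \<Rightarrow> real Matrix.vec set" where
  "real0_vecs n = {x \<in> carrier_vec n. (\<Sum>i<n. vec_index x i) = 0}"

definition int0_vecs :: "nat \<Rightarrow> real Matrix.vec set" where
  "int0_vecs n = int_vecs n \<inter> real0_vecs n"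

definition proj_int_vecs :: "nat \<Rightarrow> real Matrix.vec set" where
  "proj_int_vecs n =
     {w \<in> real0_vecs n. \<exists>x\<in>int_vecs n. \<forall>u\<in>real0_vecs n. scalar_prod (x - w) u = 0}"

text \<open>\<^term>\<open>the (mat_inverse A)\<close> is the inverse of \<^term>\<open>A\<close> whenever \<^term>\<open>A\<close> is
  invertible, as the reduced Laplacian of a connected graph is.\<close>

definition reduced_candidates :: "'a pair_pre_digraph \<Rightarrow> 'a list \<Rightarrow> real Matrix.vec set" where
  "reduced_candidates G vs =
     (\<lambda>x. the (mat_inverse (reduced_laplacian G vs)) *\<^sub>v x) ` int_vecs (length vs - 1)
       - int_vecs (length vs - 1)"

definition full_candidates :: "'a pair_pre_digraph \<Rightarrow> 'a list \<Rightarrow> real Matrix.vec set" where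
  "full_candidates G vs =
     (\<lambda>x. moore_penrose (full_laplacian G vs) *\<^sub>v x) ` int0_vecs (length vs)
       - proj_int_vecs (length vs)"

text \<open>
  Functions on the vertex set are taken extensional (\<^term>\<open>undefined\<close> off the vertices), so that
  each multiplicative harmonic function on $V$ is counted once and the set is finite, as the
  minima below require.
\<close>

definition mult_harmonic :: "'a pair_pre_digraph \<Rightarrow> 'a \<Rightarrow> ('a \<Rightarrow> complex) set" where
  "mult_harmonic G s =
     {h \<in> pverts G \<rightarrow>\<^sub>E (UNIV - {0}).
        h s = 1 \<and>
        (\<forall>v\<in>pverts G. h v ^ out_degree (with_proj G) v = (\<Prod>w | (v, w) \<in> parcs G. h w))}"

definition chain_eigenvalue :: "'a pair_pre_digraph \<Rightarrow> ('a \<Rightarrow> complex) \<Rightarrow> complex" where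
  "chain_eigenvalue G h = 1 / of_nat (card (pverts G)) * (\<Sum>v\<in>pverts G. h v)"

definition gap_continuous :: "'a pair_pre_digraph \<Rightarrow> 'a \<Rightarrow> real" where
  "gap_continuous G s =
     Min {1 - Re (chain_eigenvalue G h) | h. h \<in> mult_harmonic G s \<and> (\<exists>v\<in>pverts G. h v \<noteq> 1)}"

definition gap_discrete :: "'a pair_pre_digraph \<Rightarrow> 'a \<Rightarrow> real" where
  "gap_discrete G s =
     Min {1 - cmod (chain_eigenvalue G h) | h. h \<in> mult_harmonic G s \<and> (\<exists>v\<in>pverts G. h v \<noteq> 1)}"

end

theory Submission
  imports Defs
begin

text \<open>A multiplicative harmonic function has modulus 1 by the maximum principle, so it is
  \<open>exp (2 \<pi> i f)\<close> for a real function \<open>f\<close>, determined modulo integers, with integral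
  Laplacian. Functions \<open>f\<close> vanishing at the sink give the lattice of the reduced Laplacian; functions
  of mean zero, which forget a global phase, give the image of the pseudoinverse. Then
  \<open>1 - Re \<lambda>\<close> is the mean of \<open>1 - cos (2 \<pi> f)\<close>, which lies between \<open>8 f\<^sup>2\<close>
  (for \<open>\<bar>f\<bar> \<le> 1/2\<close>) and \<open>2 \<pi>\<^sup>2 f\<^sup>2\<close>; the modulus is handled in the same way
  after rotating by a phase.\<close>

section \<open>Quadratic bounds for the cosine\<close>

(* On each side of x the mean value theorem gives a slope of sin t - 2 t / pi; these slopes decrease. *)
lemma jordan_sin_ge:
  fixes x :: real
  assumes "0 \<le> x" and "x \<le> pi / 2"
  shows "2 * x / pi \<le> sin x"
proof (cases "x = 0 \<or> x = pi / 2")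
  case True
  then show ?thesis by (elim disjE) (simp, hypsubst, simp)
next
  case False
  with assms have x: "0 < x" "x < pi / 2" by auto
  have "\<exists>c>0. c < x \<and> sin x - sin 0 = (x - 0) * cos c"
    by (rule MVT2) (use x in \<open>auto intro!: derivative_eq_intros\<close>)
  then obtain c where c: "0 < c" "c < x" "sin x = x * cos c" by auto
  have "\<exists>d>x. d < pi / 2 \<and> sin (pi / 2) - sin x = (pi / 2 - x) * cos d"
    by (rule MVT2) (use x in \<open>auto intro!: derivative_eq_intros\<close>)
  then obtain d where d: "x < d" "d < pi / 2" "1 - sin x = (pi / 2 - x) * cos d" by auto
  have "cos d < cos c" using c d by (intro cos_monotone_0_pi) auto
  have "(pi / 2 - x) * cos d \<le> (pi / 2 - x) * cos c"
    using \<open>cos d < cos c\<close> x by (intro mult_left_mono) auto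
  \<comment> \<open>Substituting \<open>sin x = x * cos c\<close> makes the terms in
    \<open>x\<close> cancel, which leaves a bound on \<open>cos c\<close> alone.\<close>
  then have "1 \<le> pi / 2 * cos c" using c(3) d(3) by (simp add: algebra_simps)
  then have "2 / pi \<le> cos c" by (simp add: field_simps)
  then have "x * (2 / pi) \<le> x * cos c" using x by (intro mult_left_mono) auto
  then show ?thesis using c(3) by (simp add: mult.commute)
qed

lemma one_minus_cos_2pi:
  fixes t :: real
  shows "1 - cos (2 * pi * t) = 2 * (sin (pi * t))\<^sup>2"
  using cos_double_sin[of "pi * t"] by (simp add: mult.assoc)

lemma one_minus_cos_le:
  fixes t :: real
  shows "1 - cos (2 * pi * t) \<le> 2 * pi\<^sup>2 * t\<^sup>2"
proof -
  have "(sin (pi * t))\<^sup>2 \<le> (pi * t)\<^sup>2"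
    using abs_sin_x_le_abs_x[of "pi * t"] by (simp only: abs_le_square_iff)
  then show ?thesis by (simp add: one_minus_cos_2pi power_mult_distrib)
qed

text \<open>Jordan's inequality at \<open>pi * \<bar>t\<bar>\<close>, squared; the bound on
  \<open>t\<close> keeps this argument in [0, pi/2].\<close>

lemma one_minus_cos_ge:
  fixes t :: real
  assumes "\<bar>t\<bar> \<le> 1 / 2"
  shows "8 * t\<^sup>2 \<le> 1 - cos (2 * pi * t)"
proof -
  have "2 * \<bar>t\<bar> \<le> sin (pi * \<bar>t\<bar>)"
    using jordan_sin_ge[of "pi * \<bar>t\<bar>"] assms by (simp add: field_simps)
  then have "(2 * \<bar>t\<bar>)\<^sup>2 \<le> (sin (pi * \<bar>t\<bar>))\<^sup>2" by (intro power_mono) auto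
  moreover have "(sin (pi * \<bar>t\<bar>))\<^sup>2 = (sin (pi * t))\<^sup>2" by (cases "t \<ge> 0") auto
  ultimately show ?thesis by (simp add: one_minus_cos_2pi power_mult_distrib)
qed

section \<open>Unit complex numbers as exponentials of real phases\<close>

lemma cis_2pi_eq_1_iff:
  fixes t :: real
  shows "cis (2 * pi * t) = 1 \<longleftrightarrow> t \<in> \<int>"
proof
  assume "cis (2 * pi * t) = 1"
  then have "cos (2 * pi * t) = 1" by (simp add: complex_eq_iff)
  then obtain k :: int where "2 * pi * t = k * 2 * pi" by (auto simp: cos_one_2pi_int)
  then show "t \<in> \<int>" by auto
qed auto

text \<open>The principal argument supplies the phase, and its range is exactly the one on which
  \<open>one_minus_cos_ge\<close> applies.\<close>

lemma cis_2pi_surj: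
  assumes "cmod z = 1"
  obtains t where "\<bar>t\<bar> \<le> 1 / 2" "cis (2 * pi * t) = z"
proof
  show "\<bar>Arg z / (2 * pi)\<bar> \<le> 1 / 2"
    using Arg_bounded[of z] by (auto simp: field_simps abs_le_iff)
  show "cis (2 * pi * (Arg z / (2 * pi))) = z"
    using rcis_cmod_Arg[of z] assms by (simp add: rcis_def)
qed

lemma cis_sum: "finite A \<Longrightarrow> (\<Prod>a\<in>A. cis (f a)) = cis (\<Sum>a\<in>A. f a)"
  by (induction A rule: finite_induct) (auto simp: cis_mult)

text \<open>The hypothesis makes \<open>c\<close> the mean, so expanding the squares shows a drop of
  \<open>card A\<close> times the square of \<open>c\<close>. It lets a bound for arbitrary phases
  pass to their centered version.\<close>

lemma sum_sq_centered_le: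
  fixes f :: "'a \<Rightarrow> real"
  assumes "finite A" and "c * real (card A) = sum f A"
  shows "(\<Sum>a\<in>A. (f a - c)\<^sup>2) \<le> (\<Sum>a\<in>A. (f a)\<^sup>2)"
proof -
  have "(\<Sum>a\<in>A. (f a - c)\<^sup>2) = (\<Sum>a\<in>A. (f a)\<^sup>2 - 2 * c * f a + c\<^sup>2)"
    by (intro sum.cong) (auto simp: power2_eq_square algebra_simps)
  also have "\<dots> = (\<Sum>a\<in>A. (f a)\<^sup>2) - 2 * c * sum f A + real (card A) * c\<^sup>2"
    by (simp add: sum.distrib sum_subtractf sum_distrib_left)
  also have "\<dots> = (\<Sum>a\<in>A. (f a)\<^sup>2) - real (card A) * c\<^sup>2"
    by (simp add: assms(2)[symmetric] power2_eq_square)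
  finally show ?thesis by simp
qed

section \<open>Integral matrices and pseudoinverses\<close>

text \<open>The Leibniz formula is a polynomial with integer coefficients in the entries. Together
  with \<open>adj_mat_Ints\<close> this feeds the finiteness argument for harmonic
  functions.\<close>

lemma det_Ints:
  fixes A :: "'a :: comm_ring_1 mat"
  assumes "A \<in> carrier_mat n n" and "\<And>i j. i < n \<Longrightarrow> j < n \<Longrightarrow> A $$ (i, j) \<in> \<int>"
  shows "Determinant.det A \<in> \<int>"
  unfolding det_def'[OF assms(1)]
proof (intro Ints_sum Ints_mult Ints_prod)
  fix p and i
  assume "p \<in> {p. p permutes {0..<n}}" "i \<in> {0..<n}"
  then show "A $$ (i, p i) \<in> \<int>" by (intro assms) (auto simp: permutes_in_image)
qed auto

lemma adj_mat_Ints: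
  fixes A :: "'a :: comm_ring_1 mat"
  assumes A: "A \<in> carrier_mat n n" and int: "\<And>i j. i < n \<Longrightarrow> j < n \<Longrightarrow> A $$ (i, j) \<in> \<int>"
    and ij: "i < n" "j < n"
  shows "adj_mat A $$ (i, j) \<in> \<int>"
proof -
  have "Determinant.det (mat_delete A j i) \<in> \<int>"
  proof (rule det_Ints)
    show "mat_delete A j i \<in> carrier_mat (n - 1) (n - 1)" using A by auto
    fix i' j' assume "i' < n - 1" "j' < n - 1"
    then show "mat_delete A j i $$ (i', j') \<in> \<int>"
      using A ij by (auto simp: mat_delete_def intro!: int)
  qed
  then show ?thesis using A ij by (simp add: adj_mat_def cofactor_def)
qed

lemma mat_inverse_det_nonzero:
  fixes A :: "'a :: field mat"
  assumes "Determinant.det A \<noteq> 0" and A: "A \<in> carrier_mat n n"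
  obtains B where "mat_inverse A = Some B" "A * B = 1\<^sub>m n" "B * A = 1\<^sub>m n" "B \<in> carrier_mat n n"
proof -
  have "A \<in> Units (ring_mat TYPE('a) n ())" using assms by (intro det_non_zero_imp_unit)
  then obtain B where "mat_inverse A = Some B"
    using mat_inverse(1)[OF A, where b = "()"] by (cases "mat_inverse A") auto
  then show ?thesis using mat_inverse(2)[OF A] that by auto
qed

text \<open>\<open>A * B\<close> and \<open>A * C\<close> are symmetric and each absorbs the other
  on the left; transposing one absorption identity reverses its factors, so the two agree. The same
  works for \<open>B * A\<close> and \<open>C * A\<close>, and then B = BAB = CAB = CAC = C.\<close>

lemma moore_penrose_unique:
  assumes B: "is_moore_penrose A B" and C: "is_moore_penrose A C"
  shows "B = C"
proof -
  define m n where "m = dim_row A" and "n = dim_col A"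
  have A: "A \<in> carrier_mat m n" by (simp add: m_def n_def)
  have Bc: "B \<in> carrier_mat n m" and Cc: "C \<in> carrier_mat n m"
    using B C by (auto simp: is_moore_penrose_def m_def n_def)
  note b = B[unfolded is_moore_penrose_def] and c = C[unfolded is_moore_penrose_def]
  have AB: "A * B = A * C"
  proof -
    have 1: "(A * C) * (A * B) = A * B"
      using assoc_mult_mat[of "A * C" m m A n B m, symmetric] A Bc Cc c by auto
    have 2: "(A * B) * (A * C) = A * C"
      using assoc_mult_mat[of "A * B" m m A n C m, symmetric] A Bc Cc b by auto
    have "A * B = transpose_mat ((A * C) * (A * B))" using 1 b by simp
    also have "\<dots> = transpose_mat (A * B) * transpose_mat (A * C)"
      using A Bc Cc by (intro transpose_mult) auto
    also have "\<dots> = A * C" using 2 b c by simp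
    finally show ?thesis .
  qed
  have BA: "B * A = C * A"
  proof -
    have 1: "(B * A) * (C * A) = B * A"
      using assoc_mult_mat[of B n m A n "C * A" n] assoc_mult_mat[of A m n C m A n, symmetric] A Bc Cc c by auto
    have 2: "(C * A) * (B * A) = C * A"
      using assoc_mult_mat[of C n m A n "B * A" n] assoc_mult_mat[of A m n B m A n, symmetric] A Bc Cc b by auto
    have "C * A = transpose_mat ((C * A) * (B * A))" using 2 c by simp
    also have "\<dots> = transpose_mat (B * A) * transpose_mat (C * A)"
      using A Bc Cc by (intro transpose_mult) auto
    also have "\<dots> = B * A" using 1 b c by simp
    finally show ?thesis by simp
  qed
  have "B = C * A * B" using b BA by simp
  also have "\<dots> = C * (A * B)" using Cc A Bc by (rule assoc_mult_mat)
  also have "\<dots> = C * A * C" unfolding AB using Cc A Cc by (rule assoc_mult_mat[symmetric])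
  also have "\<dots> = C" using c by simp
  finally show "B = C" .
qed

lemma moore_penrose_eqI: "is_moore_penrose A B \<Longrightarrow> moore_penrose A = B"
  unfolding moore_penrose_def by (blast intro: moore_penrose_unique)

text \<open>If \<open>P\<close> is the orthogonal projection onto the kernel of a symmetric \<open>A\<close>, then \<open>A + P\<close> is
  invertible and the pseudoinverse of \<open>A\<close> is its inverse minus \<open>P\<close>.\<close>

lemma moore_penrose_symmetric:
  fixes A P :: "real mat"
  assumes A: "A \<in> carrier_mat n n" and P: "P \<in> carrier_mat n n"
    and sym: "transpose_mat P = P"
    and AP: "A * P = 0\<^sub>m n n" and PA: "P * A = 0\<^sub>m n n" and PP: "P * P = P"
    and ker: "\<And>x. x \<in> carrier_vec n \<Longrightarrow> A *\<^sub>v x = 0\<^sub>v n \<Longrightarrow> P *\<^sub>v x = 0\<^sub>v n \<Longrightarrow> x = 0\<^sub>v n"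
  shows "A * moore_penrose A = 1\<^sub>m n - P" and "moore_penrose A * A = 1\<^sub>m n - P"
    and "P * moore_penrose A = 0\<^sub>m n n" and "moore_penrose A \<in> carrier_mat n n"
proof -
  define M where "M = A + P"
  have M: "M \<in> carrier_mat n n" using A P by (simp add: M_def)
  have PM: "P * M = P" and MP: "M * P = P"
    using A P by (simp_all add: M_def mult_add_distrib_mat add_mult_distrib_mat AP PA PP)
  \<comment> \<open>If \<open>M\<close> kills \<open>x\<close>, so does \<open>P = P * M\<close>,
    hence so does \<open>A = M - P\<close>, and \<open>ker\<close> applies.\<close>
  have "Determinant.det M \<noteq> 0"
  proof
    assume "Determinant.det M = 0"
    then obtain x where x: "x \<in> carrier_vec n" "x \<noteq> 0\<^sub>v n" "M *\<^sub>v x = 0\<^sub>v n"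
      using det_0_iff_vec_prod_zero[OF M] by auto
    have "P *\<^sub>v x = (P * M) *\<^sub>v x" by (simp add: PM)
    also have "\<dots> = P *\<^sub>v (M *\<^sub>v x)" using P M x by (intro assoc_mult_mat_vec) auto
    also have "\<dots> = 0\<^sub>v n" using P x by (auto simp: x(3))
    finally have Px: "P *\<^sub>v x = 0\<^sub>v n" .
    have "A *\<^sub>v x = 0\<^sub>v n"
      using x(3) A P x(1) Px by (simp add: M_def add_mult_distrib_mat_vec)
    with ker x Px show False by auto
  qed
  then obtain N where "mat_inverse M = Some N" and MN: "M * N = 1\<^sub>m n"
    and NM: "N * M = 1\<^sub>m n" and N: "N \<in> carrier_mat n n"
    using M by (rule mat_inverse_det_nonzero)
  \<comment> \<open>\<open>M\<close> fixes the range of \<open>P\<close>, so its inverse does too;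
    this is what makes the products of \<open>A\<close> with \<open>N - P\<close> collapse to
    \<open>1\<^sub>m n - P\<close>.\<close>
  have NP: "N * P = P"
  proof -
    have "N * P = N * (M * P)" by (simp add: MP)
    also have "\<dots> = (N * M) * P" using N M P by (intro assoc_mult_mat[symmetric]) auto
    finally show ?thesis using NM P by simp
  qed
  have PN: "P * N = P"
  proof -
    have "P * N = (P * M) * N" by (simp add: PM)
    also have "\<dots> = P * (M * N)" using N M P by (intro assoc_mult_mat) auto
    finally show ?thesis using MN P by simp
  qed
  have A_eq: "A = M - P" using A P by (auto simp: M_def)
  define B where "B = N - P"
  have B: "B \<in> carrier_mat n n" using N P by (auto simp: B_def)
  have AB: "A * B = 1\<^sub>m n - P"
  proof -
    have "A * B = A * N - A * P" unfolding B_def using A N P by (intro mult_minus_distrib_mat) auto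
    also have "A * N = M * N - P * N" unfolding A_eq using M N P by (intro minus_mult_distrib_mat) auto
    finally show ?thesis using P by (auto simp: AP MN PN)
  qed
  have BA: "B * A = 1\<^sub>m n - P"
  proof -
    have "B * A = N * A - P * A" unfolding B_def using A N P by (intro minus_mult_distrib_mat) auto
    also have "N * A = N * M - N * P" unfolding A_eq using M N P by (intro mult_minus_distrib_mat) auto
    finally show ?thesis using P by (auto simp: PA NM NP)
  qed
  have PB: "P * B = 0\<^sub>m n n"
  proof -
    have "P * B = P * N - P * P" unfolding B_def using N P by (intro mult_minus_distrib_mat) auto
    then show ?thesis using P by (auto simp: PN PP)
  qed
  have "is_moore_penrose A B"
    unfolding is_moore_penrose_def
  proof (intro conjI)
    show "B \<in> carrier_mat (dim_col A) (dim_row A)" using A B by auto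
    have "(1\<^sub>m n - P) * A = 1\<^sub>m n * A - P * A" using A P by (intro minus_mult_distrib_mat) auto
    then show "A * B * A = A" using A by (auto simp: AB PA)
    have "(1\<^sub>m n - P) * B = 1\<^sub>m n * B - P * B" using B P by (intro minus_mult_distrib_mat) auto
    then show "B * A * B = B" using B by (auto simp: BA PB)
    have "transpose_mat (1\<^sub>m n - P) = 1\<^sub>m n - P"
    proof (rule eq_matI)
      fix i j assume "i < dim_row (1\<^sub>m n - P)" "j < dim_col (1\<^sub>m n - P)"
      moreover from this have "P $$ (j, i) = P $$ (i, j)"
        using P arg_cong[OF sym, of "\<lambda>Q. Q $$ (i, j)"] by auto
      ultimately show "transpose_mat (1\<^sub>m n - P) $$ (i, j) = (1\<^sub>m n - P) $$ (i, j)" using P by auto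
    qed (use P in auto)
    then show "transpose_mat (A * B) = A * B" "transpose_mat (B * A) = B * A" by (simp_all add: AB BA)
  qed
  then have "moore_penrose A = B" by (rule moore_penrose_eqI)
  then show "A * moore_penrose A = 1\<^sub>m n - P" "moore_penrose A * A = 1\<^sub>m n - P"
    "P * moore_penrose A = 0\<^sub>m n n" "moore_penrose A \<in> carrier_mat n n"
    using AB BA PB B by auto
qed

section \<open>Graph Laplacians\<close>

locale connected_graph = pair_graph G for G :: "'a pair_pre_digraph" +
  fixes vs :: "'a list"
  assumes connected_G: "Digraph_Component.connected (with_proj G)"
    and distinct_vs: "distinct vs" and set_vs: "set vs = pverts G"
begin

abbreviation n :: nat where "n \<equiv> length vs"

abbreviation s :: 'a where "s \<equiv> last vs"

definition nbrs :: "'a \<Rightarrow> 'a set" where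
  "nbrs v = {w. (v, w) \<in> parcs G}"

text \<open>In difference form, invariance under constants is immediate and all summands have one
  sign at a maximum; \<open>lap_degree\<close> recovers the form matching the matrix.\<close>

definition lap :: "('a \<Rightarrow> real) \<Rightarrow> 'a \<Rightarrow> real" where
  "lap f v = (\<Sum>w\<in>nbrs v. f v - f w)"

lemma nbrs_subset: "nbrs v \<subseteq> pverts G"
  by (auto simp: nbrs_def dest: in_arcsD2)

lemma finite_nbrs: "finite (nbrs v)"
  using nbrs_subset pair_finite_verts by (rule finite_subset)

lemma nbrs_sym: "w \<in> nbrs v \<longleftrightarrow> v \<in> nbrs w"
  by (auto simp: nbrs_def intro: arcs_symmetric)

lemma self_notin_nbrs: "v \<notin> nbrs v"
  by (auto simp: nbrs_def dest: pair_no_loops)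

lemma out_degree_eq: "out_degree (with_proj G) v = card (nbrs v)"
proof -
  have "out_arcs (with_proj G) v = Pair v ` nbrs v"
    by (auto simp: out_arcs_def nbrs_def)
  then show ?thesis by (simp add: out_degree_def card_image inj_on_def)
qed

lemma lap_degree: "lap f v = real (card (nbrs v)) * f v - sum f (nbrs v)"
  by (simp add: lap_def sum_subtractf)

lemma lap_shift: "lap (\<lambda>v. f v - c) = lap f"
  by (simp add: lap_def fun_eq_iff)

text \<open>Adjacency is symmetric, so exchanging the double sum cancels everything. Hence the value
  at the sink is determined by the values at the other vertices.\<close>

lemma sum_lap: "(\<Sum>v\<in>pverts G. lap f v) = 0"
proof -
  \<comment> \<open>Neighbour sums are extended by zero to all vertices so that the order of
    summation can be exchanged.\<close>
  have if_eq: "(\<Sum>w\<in>nbrs v. g w) = (\<Sum>w\<in>pverts G. if w \<in> nbrs v then g w else 0)"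
    for g :: "'a \<Rightarrow> real" and v
    using nbrs_subset[of v] pair_finite_verts
    by (simp add: sum.If_cases Int_absorb1)
  have "(\<Sum>v\<in>pverts G. lap f v)
      = (\<Sum>v\<in>pverts G. \<Sum>w\<in>nbrs v. f v) - (\<Sum>v\<in>pverts G. \<Sum>w\<in>nbrs v. f w)"
    by (simp only: lap_def sum_subtractf)
  also have "(\<Sum>v\<in>pverts G. \<Sum>w\<in>nbrs v. f v) = (\<Sum>w\<in>pverts G. \<Sum>v\<in>nbrs w. f v)"
    unfolding if_eq by (subst sum.swap) (simp add: nbrs_sym)
  finally show ?thesis by simp
qed

lemma vs_nonempty: "vs \<noteq> []" and n_pos: "0 < n"
  using connected_G set_vs by (auto simp: Digraph_Component.connected_def strongly_connected_def)

lemma reachable_all: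
  assumes "u \<in> pverts G" and "v \<in> pverts G"
  shows "u \<rightarrow>\<^sup>*\<^bsub>with_proj G\<^esub> v"
  using symmetric_connected_imp_strongly_connected[OF pair_sym_arcs connected_G] assms
  by (auto simp: strongly_connected_def)

(* Maximum principle: the vertices where f is maximal are closed under adjacency. *)
lemma harmonic_const:
  assumes "\<And>v. v \<in> pverts G \<Longrightarrow> lap f v = 0" and u: "u \<in> pverts G" and v: "v \<in> pverts G"
  shows "f u = f v"
proof -
  define M where "M = Max (f ` pverts G)"
  have le: "f w \<le> M" if "w \<in> pverts G" for w
    using that pair_finite_verts by (auto simp: M_def)
  have "M \<in> f ` pverts G" unfolding M_def using u pair_finite_verts by (intro Max_in) auto
  then obtain m where m: "m \<in> pverts G" "f m = M" by auto
  have "f w = M" if "w \<in> pverts G" for w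
    using reachable_all[OF m(1) that]
  proof (induction rule: reachable_induct)
    case (step x y)
    then have y: "y \<in> nbrs x" and x: "x \<in> pverts G" by (auto simp: nbrs_def dest: in_arcsD1)
    \<comment> \<open>Since \<open>f x\<close> is the maximum, the summands of
      \<open>lap f x\<close> are nonnegative, and their sum is zero.\<close>
    have "\<forall>w\<in>nbrs x. f x - f w = 0"
      using assms(1)[OF x] le nbrs_subset[of x] step.IH finite_nbrs[of x]
      by (subst (asm) lap_def, subst (asm) sum_nonneg_eq_0_iff) auto
    with y step.IH show ?case by auto
  qed (use m in auto)
  then show ?thesis using u v by simp
qed

section \<open>Vertex functions and coordinate vectors\<close>

lemma sum_verts: "(\<Sum>v\<in>pverts G. g v) = (\<Sum>i<n. g (vs ! i))"
  using sum.reindex_bij_betw[OF bij_betw_nth[OF distinct_vs refl refl], of g] by (simp add: set_vs)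

lemma sum_verts_sink: "(\<Sum>v\<in>pverts G. g v) = (\<Sum>i<n - 1. g (vs ! i)) + g s"
proof -
  have "n = Suc (n - 1)" using n_pos by simp
  then have "(\<Sum>i<n. g (vs ! i)) = (\<Sum>i<n - 1. g (vs ! i)) + g (vs ! (n - 1))"
    by (metis sum.lessThan_Suc)
  then show ?thesis by (simp add: sum_verts last_conv_nth vs_nonempty)
qed

lemma s_in: "s \<in> pverts G"
  using vs_nonempty set_vs last_in_set by auto

lemma nth_in: "i < n \<Longrightarrow> vs ! i \<in> pverts G"
  using set_vs nth_mem by auto

lemma card_verts: "card (pverts G) = n"
  using distinct_vs set_vs distinct_card by fastforce

lemma verts_sink_cases:
  assumes "v \<in> pverts G"
  obtains "v = s" | i where "i < n - 1" "v = vs ! i"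
proof -
  obtain i where i: "i < n" "v = vs ! i" using assms set_vs by (metis in_set_conv_nth)
  show ?thesis
  proof (cases "i = n - 1")
    case True
    then show ?thesis using i that(1) vs_nonempty by (simp add: last_conv_nth)
  next
    case False
    then show ?thesis using i that(2)[of i] by auto
  qed
qed

lemma sink_notin_take: "s \<notin> set (take (n - 1) vs)"
proof -
  have "distinct (butlast vs @ [s])" using distinct_vs vs_nonempty by simp
  then show ?thesis by (simp add: butlast_conv_take)
qed

abbreviation vec_of :: "nat \<Rightarrow> ('a \<Rightarrow> real) \<Rightarrow> real vec" where
  "vec_of m f \<equiv> Matrix.vec m (\<lambda>i. f (vs ! i))"

text \<open>The extension by zero matters for \<open>m = n - 1\<close>, where it makes the function
  vanish at the sink.\<close>

lemma vec_of_surj: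
  assumes "x \<in> carrier_vec m" and "m \<le> n"
  obtains f where "x = vec_of m f" "\<And>v. v \<notin> set (take m vs) \<Longrightarrow> f v = 0"
proof
  \<comment> \<open>Distinctness leaves one summand for a vertex among the first \<open>m\<close>,
    and the sum is empty elsewhere, giving the default 0.\<close>
  define f where "f v = (\<Sum>i | i < m \<and> vs ! i = v. x $ i)" for v
  show "x = vec_of m f"
  proof (rule eq_vecI)
    fix i assume "i < dim_vec (vec_of m f)"
    then have i: "i < m" by simp
    have "{j. j < m \<and> vs ! j = vs ! i} = {i}"
      using i assms(2) distinct_vs by (auto simp: nth_eq_iff_index_eq)
    then show "x $ i = vec_of m f $ i" using i by (simp add: f_def)
  qed (use assms in auto)
  fix v assume "v \<notin> set (take m vs)"
  then have "{i. i < m \<and> vs ! i = v} = {}" using assms(2) by (auto simp: in_set_conv_nth)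
  then show "f v = 0" by (simp only: f_def sum.empty)
qed

section \<open>The Laplacian matrices as operators on vertex functions\<close>

abbreviation L :: "real mat" where "L \<equiv> full_laplacian G vs"

abbreviation R :: "real mat" where "R \<equiv> reduced_laplacian G vs"

lemma L_carrier: "L \<in> carrier_mat n n"
  by (simp add: full_laplacian_def)

lemma R_carrier: "R \<in> carrier_mat (n - 1) (n - 1)"
  unfolding reduced_laplacian_def using L_carrier by (rule mat_delete_carrier)

lemma L_index: "i < n \<Longrightarrow> j < n \<Longrightarrow> L $$ (i, j) =
    (if i = j then real (card (nbrs (vs ! i))) else if vs ! j \<in> nbrs (vs ! i) then - 1 else 0)"
  by (simp add: full_laplacian_def out_degree_eq nbrs_def)

lemma R_index: "i < n - 1 \<Longrightarrow> j < n - 1 \<Longrightarrow> R $$ (i, j) = L $$ (i, j)"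
  using L_carrier by (simp add: reduced_laplacian_def mat_delete_def)

lemma L_row_sum:
  assumes "i < n"
  shows "(\<Sum>j<n. L $$ (i, j) * f (vs ! j)) = lap f (vs ! i)"
proof -
  let ?v = "vs ! i"
  have v: "?v \<in> pverts G" using assms by (rule nth_in)
  \<comment> \<open>The row splits into a diagonal and a neighbour indicator, which do not overlap
    because there are no loops.\<close>
  have "(\<Sum>j<n. L $$ (i, j) * f (vs ! j)) =
      (\<Sum>j<n. (if vs ! j = ?v then real (card (nbrs ?v)) * f ?v else 0)
        - (if vs ! j \<in> nbrs ?v then f (vs ! j) else 0))"
    using assms distinct_vs by (intro sum.cong) (auto simp: L_index nth_eq_iff_index_eq self_notin_nbrs)
  also have "\<dots> = (\<Sum>w\<in>pverts G. (if w = ?v then real (card (nbrs ?v)) * f ?v else 0)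
        - (if w \<in> nbrs ?v then f w else 0))"
    by (simp add: sum_verts)
  also have "\<dots> = real (card (nbrs ?v)) * f ?v - sum f (nbrs ?v)"
    using v pair_finite_verts nbrs_subset[of ?v]
    by (simp add: sum_subtractf sum.If_cases Int_absorb1)
  finally show ?thesis by (simp add: lap_degree)
qed

lemma L_mult: "L *\<^sub>v vec_of n f = vec_of n (lap f)"
proof (rule eq_vecI)
  fix i assume "i < dim_vec (vec_of n (lap f))"
  then have "i < n" by simp
  then show "(L *\<^sub>v vec_of n f) $ i = vec_of n (lap f) $ i"
    using L_carrier L_row_sum[of i f] by (simp add: scalar_prod_def lessThan_atLeast0)
qed (use L_carrier in auto)

text \<open>The deleted column would only contribute a multiple of \<open>f s = 0\<close>.\<close>

lemma R_mult:
  assumes "f s = 0"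
  shows "R *\<^sub>v vec_of (n - 1) f = vec_of (n - 1) (lap f)"
proof (rule eq_vecI)
  fix i assume "i < dim_vec (vec_of (n - 1) (lap f))"
  then have i: "i < n - 1" by simp
  have n: "n = Suc (n - 1)" using n_pos by simp
  have "(\<Sum>j<n. L $$ (i, j) * f (vs ! j)) =
      (\<Sum>j<n - 1. L $$ (i, j) * f (vs ! j)) + L $$ (i, n - 1) * f (vs ! (n - 1))"
    by (subst n, subst sum.lessThan_Suc) simp
  then have "(\<Sum>j<n - 1. L $$ (i, j) * f (vs ! j)) = lap f (vs ! i)"
    using i L_row_sum[of i f] assms vs_nonempty by (simp add: last_conv_nth)
  moreover have "(\<Sum>j<n - 1. R $$ (i, j) * f (vs ! j)) = (\<Sum>j<n - 1. L $$ (i, j) * f (vs ! j))"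
    using i by (intro sum.cong) (auto simp: R_index)
  ultimately show "(R *\<^sub>v vec_of (n - 1) f) $ i = vec_of (n - 1) (lap f) $ i"
    using i R_carrier by (simp add: scalar_prod_def lessThan_atLeast0)
qed (use R_carrier in auto)

section \<open>Invertibility and candidate vectors as functions with integral Laplacian\<close>

lemma det_R_nonzero: "Determinant.det R \<noteq> 0"
proof
  assume "Determinant.det R = 0"
  then obtain x where x: "x \<in> carrier_vec (n - 1)" "x \<noteq> 0\<^sub>v (n - 1)" "R *\<^sub>v x = 0\<^sub>v (n - 1)"
    using det_0_iff_vec_prod_zero[OF R_carrier] by auto
  obtain f where f: "x = vec_of (n - 1) f" and f0: "\<And>v. v \<notin> set (take (n - 1) vs) \<Longrightarrow> f v = 0"
    using vec_of_surj[OF x(1)] by auto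
  have fs: "f s = 0" by (rule f0) (rule sink_notin_take)
  have lap0: "lap f (vs ! i) = 0" if "i < n - 1" for i
  proof -
    have "lap f (vs ! i) = (R *\<^sub>v x) $ i" unfolding f R_mult[of f, OF fs] using that by simp
    then show ?thesis using that by (simp add: x(3))
  qed
  \<comment> \<open>The kernel equation says nothing about the deleted row; it follows from
    \<open>sum_lap\<close>. Then \<open>f\<close> is harmonic everywhere, hence constantly equal to
    its sink value 0.\<close>
  have "lap f s = 0" using sum_lap[of f] lap0 by (simp add: sum_verts_sink)
  have "lap f v = 0" if "v \<in> pverts G" for v
    using that by (cases rule: verts_sink_cases) (use lap0 \<open>lap f s = 0\<close> in auto)
  then have "f v = 0" if "v \<in> pverts G" for v
    using harmonic_const[of f v s] that s_in fs by auto
  then have "x = 0\<^sub>v (n - 1)" using nth_in by (auto simp: f intro!: eq_vecI)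
  with x(2) show False by simp
qed

text \<open>Applying \<open>R\<close> undoes its inverse, so a lattice vector, extended by 0 at the
  sink, is a function with integral Laplacian off the sink.\<close>

lemma reduced_candidates_iff:
  "y \<in> reduced_candidates G vs \<longleftrightarrow>
    (\<exists>f. f s = 0 \<and> (\<forall>v\<in>pverts G. lap f v \<in> \<int>) \<and> (\<exists>v\<in>pverts G. f v \<notin> \<int>) \<and> y = vec_of (n - 1) f)"
proof -
  obtain B where B: "mat_inverse R = Some B" "R * B = 1\<^sub>m (n - 1)" "B * R = 1\<^sub>m (n - 1)"
    "B \<in> carrier_mat (n - 1) (n - 1)"
    using det_R_nonzero R_carrier by (rule mat_inverse_det_nonzero)
  have cand: "y \<in> reduced_candidates G vs \<longleftrightarrow>
      y \<in> (\<lambda>x. B *\<^sub>v x) ` int_vecs (n - 1) \<and> y \<notin> int_vecs (n - 1)"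
    by (simp add: reduced_candidates_def B(1))
  \<comment> \<open>The omitted sink coordinate is 0, an integer, so a nonintegral value can only
    occur at a listed coordinate.\<close>
  have nonint: "vec_of (n - 1) f \<notin> int_vecs (n - 1) \<longleftrightarrow> (\<exists>v\<in>pverts G. f v \<notin> \<int>)" if "f s = 0" for f
  proof -
    have "f v \<in> \<int>" if "v \<in> pverts G" "\<forall>i<n - 1. f (vs ! i) \<in> \<int>" for v
      using that(1) by (cases rule: verts_sink_cases) (use that(2) \<open>f s = 0\<close> in auto)
    moreover have "vs ! i \<in> pverts G" if "i < n - 1" for i using that by (intro nth_in) simp
    ultimately show ?thesis by (auto simp: int_vecs_def)
  qed
  show ?thesis
  proof
    assume y: "y \<in> reduced_candidates G vs"
    then obtain x where x: "x \<in> int_vecs (n - 1)" "y = B *\<^sub>v x" by (auto simp: cand)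
    have xc: "x \<in> carrier_vec (n - 1)" using x by (simp add: int_vecs_def)
    have yc: "y \<in> carrier_vec (n - 1)" using mult_mat_vec_carrier[OF B(4) xc] x(2) by simp
    have Ry: "R *\<^sub>v y = x"
      using assoc_mult_mat_vec[OF R_carrier B(4) xc] B(2) xc by (simp add: x(2))
    obtain f where f: "y = vec_of (n - 1) f" and f0: "\<And>v. v \<notin> set (take (n - 1) vs) \<Longrightarrow> f v = 0"
      using vec_of_surj[OF yc] by auto
    have fs: "f s = 0" by (rule f0) (rule sink_notin_take)
    have int: "lap f (vs ! i) \<in> \<int>" if "i < n - 1" for i
    proof -
      have "x $ i = lap f (vs ! i)" unfolding Ry[symmetric] f R_mult[of f, OF fs] using that by simp
      then show ?thesis using x(1) that by (auto simp: int_vecs_def)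
    qed
    \<comment> \<open>Integrality at the sink is inherited from the other vertices, because the
      Laplacian values sum to zero.\<close>
    have "lap f s = - (\<Sum>i<n - 1. lap f (vs ! i))" using sum_lap[of f] by (simp add: sum_verts_sink)
    then have "lap f s \<in> \<int>" using int by (auto intro!: Ints_sum)
    then have "\<forall>v\<in>pverts G. lap f v \<in> \<int>" using int by (auto elim: verts_sink_cases)
    with y f fs show "\<exists>f. f s = 0 \<and> (\<forall>v\<in>pverts G. lap f v \<in> \<int>) \<and> (\<exists>v\<in>pverts G. f v \<notin> \<int>) \<and> y = vec_of (n - 1) f"
      using nonint cand by blast
  next
    assume "\<exists>f. f s = 0 \<and> (\<forall>v\<in>pverts G. lap f v \<in> \<int>) \<and> (\<exists>v\<in>pverts G. f v \<notin> \<int>) \<and> y = vec_of (n - 1) f"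
    then obtain f where f: "f s = 0" "\<forall>v\<in>pverts G. lap f v \<in> \<int>" "\<exists>v\<in>pverts G. f v \<notin> \<int>"
      "y = vec_of (n - 1) f" by blast
    have "B *\<^sub>v (R *\<^sub>v y) = y"
      using assoc_mult_mat_vec[OF B(4) R_carrier, of y] B(3) f(4) by simp
    moreover have "R *\<^sub>v y \<in> int_vecs (n - 1)"
      unfolding f(4) R_mult[of f, OF f(1)] using f(2) nth_in by (auto simp: int_vecs_def)
    ultimately have "y \<in> (\<lambda>x. B *\<^sub>v x) ` int_vecs (n - 1)" by (metis imageI)
    moreover have "y \<notin> int_vecs (n - 1)" unfolding f(4) using nonint[of f, OF f(1)] f(3) by blast
    ultimately show "y \<in> reduced_candidates G vs" unfolding cand by blast
  qed
qed

text \<open>The orthogonal complement of the sum-zero vectors consists of the constant vectors, so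
  projecting an integer vector shifts all its entries by one constant.\<close>

lemma proj_int_vecs_iff:
  assumes f0: "(\<Sum>v\<in>pverts G. f v) = 0"
  shows "vec_of n f \<in> proj_int_vecs n \<longleftrightarrow> (\<exists>c. \<forall>v\<in>pverts G. f v - c \<in> \<int>)"
proof
  assume "vec_of n f \<in> proj_int_vecs n"
  then obtain x where x: "x \<in> int_vecs n"
    and orth: "\<And>u. u \<in> real0_vecs n \<Longrightarrow> (x - vec_of n f) \<bullet> u = 0"
    by (auto simp: proj_int_vecs_def)
  have diff: "x $ i - f (vs ! i) = x $ 0 - f (vs ! 0)" if i: "i < n" for i
  proof -
    \<comment> \<open>Testing orthogonality against this difference of two unit vectors forces
      \<open>x - vec_of n f\<close> to have equal entries at \<open>i\<close> and 0.\<close>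
    define u where "u = Matrix.vec n (\<lambda>k. (if k = i then 1 else 0) - (if k = 0 then 1 else 0) :: real)"
    have "u \<in> real0_vecs n" using i n_pos by (simp add: real0_vecs_def u_def sum_subtractf)
    then have "0 = (x - vec_of n f) \<bullet> u" by (simp add: orth)
    also have "\<dots> = (\<Sum>k<n. (if k = i then x $ i - f (vs ! i) else 0) - (if k = 0 then x $ 0 - f (vs ! 0) else 0))"
      unfolding scalar_prod_def using x by (intro sum.cong) (auto simp: u_def int_vecs_def)
    also have "\<dots> = (x $ i - f (vs ! i)) - (x $ 0 - f (vs ! 0))"
      using i n_pos by (simp add: sum_subtractf)
    finally show ?thesis by simp
  qed
  have "f v - (f (vs ! 0) - x $ 0) \<in> \<int>" if v: "v \<in> pverts G" for v
  proof -
    obtain i where i: "i < n" "v = vs ! i" using v set_vs by (metis in_set_conv_nth)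
    then have "f v - (f (vs ! 0) - x $ 0) = x $ i" using diff[of i] by simp
    then show ?thesis using x i by (auto simp: int_vecs_def)
  qed
  then show "\<exists>c. \<forall>v\<in>pverts G. f v - c \<in> \<int>" by blast
next
  assume "\<exists>c. \<forall>v\<in>pverts G. f v - c \<in> \<int>"
  then obtain c where c: "\<And>v. v \<in> pverts G \<Longrightarrow> f v - c \<in> \<int>" by blast
  let ?x = "vec_of n (\<lambda>v. f v - c)"
  have "?x \<in> int_vecs n" using c nth_in by (auto simp: int_vecs_def)
  moreover have "(?x - vec_of n f) \<bullet> u = 0" if "u \<in> real0_vecs n" for u
  proof -
    have "(?x - vec_of n f) \<bullet> u = (\<Sum>k<n. - c * u $ k)"
      unfolding scalar_prod_def using that by (intro sum.cong) (auto simp: real0_vecs_def)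
    also have "\<dots> = 0" using that by (simp add: real0_vecs_def sum_distrib_left[symmetric] sum_negf)
    finally show ?thesis .
  qed
  moreover have "vec_of n f \<in> real0_vecs n" using f0 by (simp add: real0_vecs_def sum_verts)
  ultimately show "vec_of n f \<in> proj_int_vecs n" by (auto simp: proj_int_vecs_def)
qed

section \<open>Projection onto the constants and the pseudoinverse of the full Laplacian\<close>

definition mean_mat :: "real mat" where
  "mean_mat = Matrix.mat n n (\<lambda>_. 1 / real n)"

lemma mean_mat_carrier: "mean_mat \<in> carrier_mat n n"
  by (simp add: mean_mat_def)

lemma mean_mat_mult: "mean_mat *\<^sub>v vec_of n f = Matrix.vec n (\<lambda>_. (\<Sum>v\<in>pverts G. f v) / real n)"
  by (rule eq_vecI)
    (auto simp: mean_mat_def scalar_prod_def sum_verts lessThan_atLeast0 sum_divide_distrib)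

lemma L_mult_mean: "L * mean_mat = 0\<^sub>m n n"
proof (rule eq_matI)
  fix i j assume "i < dim_row (0\<^sub>m n n)" "j < dim_col (0\<^sub>m n n)"
  then have ij: "i < n" "j < n" by auto
  then have "(L * mean_mat) $$ (i, j) = (\<Sum>k<n. L $$ (i, k) * (1 / real n))"
    using L_carrier by (simp add: mean_mat_def scalar_prod_def lessThan_atLeast0)
  also have "\<dots> = 0" using L_row_sum[OF ij(1), of "\<lambda>_. 1 / real n"] by (simp add: lap_def)
  finally show "(L * mean_mat) $$ (i, j) = 0\<^sub>m n n $$ (i, j)" using ij by simp
qed (use L_carrier mean_mat_carrier in auto)

lemma L_sym: "transpose_mat L = L"
proof (rule eq_matI)
  fix i j assume "i < dim_row L" "j < dim_col L"
  then show "transpose_mat L $$ (i, j) = L $$ (i, j)"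
    using L_carrier nbrs_sym[of "vs ! i" "vs ! j"] by (auto simp: L_index)
qed (use L_carrier in auto)

lemma mean_sym: "transpose_mat mean_mat = mean_mat"
  by (auto simp: mean_mat_def)

lemma mean_mult_L: "mean_mat * L = 0\<^sub>m n n"
proof -
  have "transpose_mat (L * mean_mat) = mean_mat * L"
    using transpose_mult[OF L_carrier mean_mat_carrier] by (simp add: L_sym mean_sym)
  then show ?thesis by (simp add: L_mult_mean)
qed

lemma mean_mult_mean: "mean_mat * mean_mat = mean_mat"
  by (rule eq_matI) (auto simp: mean_mat_def scalar_prod_def)

text \<open>A kernel vector of \<open>L\<close> is constant by connectedness, and zero mean kills
  the constant. This is the nondegeneracy condition of \<open>moore_penrose_symmetric\<close> with
  \<open>mean_mat\<close> as the projection.\<close>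

lemma L_mean_kernel:
  assumes x: "x \<in> carrier_vec n" "L *\<^sub>v x = 0\<^sub>v n" "mean_mat *\<^sub>v x = 0\<^sub>v n"
  shows "x = 0\<^sub>v n"
proof -
  obtain f where f: "x = vec_of n f" using vec_of_surj[OF x(1)] by auto
  have lap0: "lap f (vs ! i) = 0" if "i < n" for i
    using that arg_cong[OF x(2), of "\<lambda>x. x $ i"] by (simp add: f L_mult)
  have "lap f v = 0" if "v \<in> pverts G" for v
    using that lap0 set_vs by (metis in_set_conv_nth)
  then have const: "f v = f s" if "v \<in> pverts G" for v
    using that s_in harmonic_const[of f v s] by auto
  then have "(\<Sum>v\<in>pverts G. f v) = real n * f s" by (simp add: card_verts)
  moreover have "(\<Sum>v\<in>pverts G. f v) / real n = 0"
    using n_pos arg_cong[OF x(3), of "\<lambda>x. x $ 0"] by (simp add: f mean_mat_mult)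
  ultimately have "f s = 0" using n_pos by simp
  then show ?thesis using const nth_in by (auto simp: f intro!: eq_vecI)
qed

text \<open>Both products of \<open>L\<close> with its pseudoinverse are the identity minus
  averaging, so the two are mutually inverse on sum-zero vectors. The excluded vectors are
  translated by \<open>proj_int_vecs_iff\<close>.\<close>

lemma full_candidates_iff:
  "z \<in> full_candidates G vs \<longleftrightarrow>
    (\<exists>f. (\<Sum>v\<in>pverts G. f v) = 0 \<and> (\<forall>v\<in>pverts G. lap f v \<in> \<int>) \<and>
      \<not> (\<exists>c. \<forall>v\<in>pverts G. f v - c \<in> \<int>) \<and> z = vec_of n f)"
proof -
  define B where "B = moore_penrose L"
  have mp: "L * B = 1\<^sub>m n - mean_mat" "B * L = 1\<^sub>m n - mean_mat"
    "mean_mat * B = 0\<^sub>m n n" "B \<in> carrier_mat n n"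
    unfolding B_def
    by (rule moore_penrose_symmetric[OF L_carrier mean_mat_carrier mean_sym L_mult_mean
          mean_mult_L mean_mult_mean], erule (2) L_mean_kernel)+
  have proj: "(1\<^sub>m n - mean_mat) *\<^sub>v vec_of n f = vec_of n f"
    if "(\<Sum>v\<in>pverts G. f v) = 0" for f
    using mean_mat_carrier that
    by (subst minus_mult_distrib_mat_vec[of _ n n]) (auto simp: mean_mat_mult)
  have cand: "z \<in> full_candidates G vs \<longleftrightarrow>
      z \<in> (\<lambda>x. B *\<^sub>v x) ` int0_vecs n \<and> z \<notin> proj_int_vecs n"
    by (simp add: full_candidates_def B_def)
  show ?thesis
  proof
    assume z: "z \<in> full_candidates G vs"
    then obtain x where x: "x \<in> int0_vecs n" "z = B *\<^sub>v x" by (auto simp: cand)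
    have xc: "x \<in> carrier_vec n" using x by (simp add: int0_vecs_def int_vecs_def)
    then obtain g where g: "x = vec_of n g" using vec_of_surj[OF xc] by auto
    have g0: "(\<Sum>v\<in>pverts G. g v) = 0"
      using x(1) by (simp add: g int0_vecs_def real0_vecs_def sum_verts)
    have zc: "z \<in> carrier_vec n" unfolding x(2) using mp(4) xc by (rule mult_mat_vec_carrier)
    then obtain f where f: "z = vec_of n f" using vec_of_surj[OF zc] by auto
    have "L *\<^sub>v z = (L * B) *\<^sub>v x"
      unfolding x(2) using L_carrier mp(4) xc by (rule assoc_mult_mat_vec[symmetric])
    also have "\<dots> = x" unfolding mp(1) g using g0 by (rule proj)
    finally have "L *\<^sub>v z = x" .
    then have "vec_of n (lap f) = vec_of n g" by (simp add: f g L_mult)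
    then have "vec_of n (lap f) $ i = vec_of n g $ i" for i by simp
    then have lap_g: "lap f (vs ! i) = g (vs ! i)" if "i < n" for i
      using that by (metis index_vec)
    have "lap f v \<in> \<int>" if v: "v \<in> pverts G" for v
    proof -
      obtain i where i: "i < n" "v = vs ! i" using v set_vs by (metis in_set_conv_nth)
      then show ?thesis using x(1) lap_g[of i] by (auto simp: g int0_vecs_def int_vecs_def)
    qed
    \<comment> \<open>The range of the pseudoinverse is sum-zero because \<open>mean_mat * B\<close>
      vanishes.\<close>
    moreover have f0: "(\<Sum>v\<in>pverts G. f v) = 0"
    proof -
      have "mean_mat *\<^sub>v z = (mean_mat * B) *\<^sub>v x"
        unfolding x(2) using mean_mat_carrier mp(4) xc by (rule assoc_mult_mat_vec[symmetric])
      also have "\<dots> = 0\<^sub>v n"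
        unfolding mp(3) using xc by (intro eq_vecI) (auto simp: scalar_prod_def)
      finally have "mean_mat *\<^sub>v z = 0\<^sub>v n" .
      then have "(mean_mat *\<^sub>v z) $ 0 = 0" using n_pos by simp
      then show ?thesis using n_pos by (simp add: f mean_mat_mult)
    qed
    ultimately show "\<exists>f. (\<Sum>v\<in>pverts G. f v) = 0 \<and> (\<forall>v\<in>pverts G. lap f v \<in> \<int>) \<and>
      \<not> (\<exists>c. \<forall>v\<in>pverts G. f v - c \<in> \<int>) \<and> z = vec_of n f"
      using z f proj_int_vecs_iff[OF f0] cand by blast
  next
    assume "\<exists>f. (\<Sum>v\<in>pverts G. f v) = 0 \<and> (\<forall>v\<in>pverts G. lap f v \<in> \<int>) \<and>
      \<not> (\<exists>c. \<forall>v\<in>pverts G. f v - c \<in> \<int>) \<and> z = vec_of n f"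
    then obtain f where f: "(\<Sum>v\<in>pverts G. f v) = 0" "\<And>v. v \<in> pverts G \<Longrightarrow> lap f v \<in> \<int>"
      "\<not> (\<exists>c. \<forall>v\<in>pverts G. f v - c \<in> \<int>)" "z = vec_of n f" by blast
    have "vec_of n f \<in> carrier_vec n" by simp
    then have "B *\<^sub>v (L *\<^sub>v z) = z"
      using proj[OF f(1)] unfolding f(4) by (subst assoc_mult_mat_vec[OF mp(4) L_carrier, symmetric]) (auto simp: mp(2))
    moreover have "L *\<^sub>v z \<in> int0_vecs n"
      using f(2) nth_in sum_lap[of f]
      by (auto simp: f(4) L_mult int0_vecs_def int_vecs_def real0_vecs_def sum_verts)
    ultimately have "z \<in> (\<lambda>x. B *\<^sub>v x) ` int0_vecs n" by (metis imageI)
    moreover have "z \<notin> proj_int_vecs n" unfolding f(4) proj_int_vecs_iff[OF f(1)] by (rule f(3))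
    ultimately show "z \<in> full_candidates G vs" unfolding cand by blast
  qed
qed

section \<open>Multiplicative harmonic functions\<close>

text \<open>The quotient of the two sides is \<open>cis (2 * pi * lap f v)\<close>, which is 1
  exactly for integral \<open>lap f v\<close>.\<close>

lemma cis_harmonic_iff:
  assumes h: "\<And>w. w \<in> pverts G \<Longrightarrow> h w = cis (2 * pi * f w)" and v: "v \<in> pverts G"
  shows "h v ^ card (nbrs v) = (\<Prod>w\<in>nbrs v. h w) \<longleftrightarrow> lap f v \<in> \<int>"
proof -
  define a where "a = real (card (nbrs v)) * (2 * pi * f v)"
  define b where "b = (\<Sum>w\<in>nbrs v. 2 * pi * f w)"
  have "h v ^ card (nbrs v) = cis a" by (simp add: h[OF v] DeMoivre a_def)
  moreover have "(\<Prod>w\<in>nbrs v. h w) = cis b"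
  proof -
    have "(\<Prod>w\<in>nbrs v. h w) = (\<Prod>w\<in>nbrs v. cis (2 * pi * f w))"
      using nbrs_subset h by (intro prod.cong) auto
    then show ?thesis by (simp add: cis_sum finite_nbrs b_def)
  qed
  moreover have "cis a = cis b \<longleftrightarrow> cis (a - b) = 1"
    by (simp add: cis_divide[symmetric] divide_eq_eq)
  moreover have "a - b = 2 * pi * lap f v"
    unfolding a_def b_def lap_degree sum_distrib_left[symmetric] by (simp add: algebra_simps)
  ultimately show ?thesis by (simp only: cis_2pi_eq_1_iff)
qed

lemma mult_harmonic_iff:
  "h \<in> mult_harmonic G s \<longleftrightarrow> h \<in> pverts G \<rightarrow>\<^sub>E (UNIV - {0}) \<and> h s = 1 \<and>
    (\<forall>v\<in>pverts G. h v ^ card (nbrs v) = (\<Prod>w\<in>nbrs v. h w))"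
  by (auto simp: mult_harmonic_def out_degree_eq nbrs_def)

(* log |h| is harmonic, hence constant, and it vanishes at the sink. *)
lemma mult_harmonic_norm:
  assumes h: "h \<in> mult_harmonic G s" and v: "v \<in> pverts G"
  shows "cmod (h v) = 1"
proof -
  define f where "f v = ln (cmod (h v))" for v
  have nz: "cmod (h v) > 0" if "v \<in> pverts G" for v
    using h that by (auto simp: mult_harmonic_iff)
  have "lap f v = 0" if v: "v \<in> pverts G" for v
  proof -
    have "cmod (h v) ^ card (nbrs v) = (\<Prod>w\<in>nbrs v. cmod (h w))"
      using h v by (metis mult_harmonic_iff norm_power prod_norm)
    then have "ln (cmod (h v) ^ card (nbrs v)) = ln (\<Prod>w\<in>nbrs v. cmod (h w))" by simp
    also have "\<dots> = (\<Sum>w\<in>nbrs v. f w)"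
      unfolding f_def using nz nbrs_subset finite_nbrs by (intro ln_prod) auto
    finally show ?thesis using nz[OF v] by (simp add: lap_degree f_def ln_realpow)
  qed
  then have "f v = f s" using v s_in harmonic_const[of f v s] by auto
  also have "f s = 0" using h by (simp add: f_def mult_harmonic_iff)
  finally show ?thesis using nz[OF v] by (simp add: f_def)
qed

text \<open>A constant phase multiplies both sides of the equation at \<open>v\<close> by the same
  power of \<open>r\<close>, so the local equations survive although the normalization at the sink
  may be lost.\<close>

lemma rotated_mult_harmonic_repr:
  assumes h: "h \<in> mult_harmonic G s" and r: "cmod r = 1"
  obtains f where "\<And>v. v \<in> pverts G \<Longrightarrow> \<bar>f v\<bar> \<le> 1 / 2"
    "\<And>v. v \<in> pverts G \<Longrightarrow> cis (2 * pi * f v) = r * h v"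
    "\<And>v. v \<in> pverts G \<Longrightarrow> lap f v \<in> \<int>"
proof -
  have "\<forall>v\<in>pverts G. \<exists>t. \<bar>t\<bar> \<le> 1 / 2 \<and> cis (2 * pi * t) = r * h v"
    using mult_harmonic_norm[OF h] r by (metis cis_2pi_surj norm_mult mult_1)
  then obtain f where f: "\<forall>v\<in>pverts G. \<bar>f v\<bar> \<le> 1 / 2 \<and> cis (2 * pi * f v) = r * h v"
    by metis
  have "lap f v \<in> \<int>" if v: "v \<in> pverts G" for v
  proof -
    have "(r * h v) ^ card (nbrs v) = (\<Prod>w\<in>nbrs v. r * h w)"
      using h v by (simp add: mult_harmonic_iff power_mult_distrib prod.distrib)
    then show ?thesis using f v cis_harmonic_iff[of "\<lambda>v. r * h v" f v] by auto
  qed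
  then show ?thesis using f by (intro that[of f]) auto
qed

text \<open>With no rotation, the phase at the sink is an integer of absolute value at most 1/2,
  hence 0.\<close>

lemma mult_harmonic_repr:
  assumes h: "h \<in> mult_harmonic G s"
  obtains f where "\<And>v. v \<in> pverts G \<Longrightarrow> \<bar>f v\<bar> \<le> 1 / 2"
    "\<And>v. v \<in> pverts G \<Longrightarrow> h v = cis (2 * pi * f v)"
    "\<And>v. v \<in> pverts G \<Longrightarrow> lap f v \<in> \<int>" "f s = 0"
proof -
  obtain f where f: "\<And>v. v \<in> pverts G \<Longrightarrow> \<bar>f v\<bar> \<le> 1 / 2"
    "\<And>v. v \<in> pverts G \<Longrightarrow> cis (2 * pi * f v) = 1 * h v"
    "\<And>v. v \<in> pverts G \<Longrightarrow> lap f v \<in> \<int>"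
    using rotated_mult_harmonic_repr[OF h, of 1] by auto
  have "f s \<in> \<int>" using f(2)[OF s_in] h by (simp add: mult_harmonic_iff cis_2pi_eq_1_iff)
  moreover have "\<bar>f s\<bar> < 1" using f(1)[OF s_in] by simp
  ultimately have "f s = 0" using Ints_nonzero_abs_less1 by blast
  then show ?thesis using f by (intro that[of f]) auto
qed

lemma cis_mult_harmonic:
  assumes "f s \<in> \<int>" and "\<And>v. v \<in> pverts G \<Longrightarrow> lap f v \<in> \<int>"
  shows "restrict (\<lambda>v. cis (2 * pi * f v)) (pverts G) \<in> mult_harmonic G s"
  unfolding mult_harmonic_iff
  using assms s_in cis_harmonic_iff[of "restrict (\<lambda>v. cis (2 * pi * f v)) (pverts G)" f]
  by (auto simp: cis_2pi_eq_1_iff cis_neq_zero)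

(* By Cramer's rule det R annihilates the lattice R^-1 Z^(n-1) modulo Z^(n-1), so harmonic
   functions take values in a fixed finite group of roots of unity. *)
lemma finite_mult_harmonic: "finite (mult_harmonic G s)"
proof -
  have R_int: "R $$ (i, j) \<in> \<int>" if "i < n - 1" "j < n - 1" for i j
    using that by (simp add: R_index L_index)
  define D where "D = Determinant.det R"
  have "D \<in> \<int>" unfolding D_def using R_carrier R_int by (rule det_Ints)
  then obtain d where d: "D = of_int d" by (auto elim: Ints_cases)
  have "d \<noteq> 0" using det_R_nonzero d D_def by auto
  have Df: "D * f v \<in> \<int>"
    if lap: "\<And>v. v \<in> pverts G \<Longrightarrow> lap f v \<in> \<int>" and fs: "f s = 0" and v: "v \<in> pverts G" for f v
    using v
  proof (cases rule: verts_sink_cases)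
    case (2 i)
    note adj = adj_mat[OF R_carrier]
    have "adj_mat R *\<^sub>v (R *\<^sub>v vec_of (n - 1) f) = (adj_mat R * R) *\<^sub>v vec_of (n - 1) f"
      using adj R_carrier by (intro assoc_mult_mat_vec[symmetric]) auto
    also have "\<dots> = D \<cdot>\<^sub>v (1\<^sub>m (n - 1) *\<^sub>v vec_of (n - 1) f)" unfolding adj(3) D_def by auto
    also have "\<dots> = D \<cdot>\<^sub>v vec_of (n - 1) f" by simp
    finally have "(adj_mat R *\<^sub>v vec_of (n - 1) (lap f)) $ i = (D \<cdot>\<^sub>v vec_of (n - 1) f) $ i"
      by (simp only: R_mult[of f, OF fs])
    then have "D * f v = (\<Sum>j<n - 1. adj_mat R $$ (i, j) * lap f (vs ! j))"
      using adj(1) 2 by (simp add: scalar_prod_def lessThan_atLeast0)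
    also have "\<dots> \<in> \<int>"
      using 2 lap nth_in R_int by (intro Ints_sum Ints_mult adj_mat_Ints[OF R_carrier]) auto
    finally show ?thesis .
  qed (use fs in auto)
  have "h v ^ nat \<bar>d\<bar> = 1" if h: "h \<in> mult_harmonic G s" and v: "v \<in> pverts G" for h v
  proof -
    obtain f where f: "\<And>v. v \<in> pverts G \<Longrightarrow> h v = cis (2 * pi * f v)"
      "\<And>v. v \<in> pverts G \<Longrightarrow> lap f v \<in> \<int>" "f s = 0"
      using mult_harmonic_repr[OF h] by metis
    \<comment> \<open>The absolute value turns the determinant into a natural exponent; it is
      positive since \<open>d \<noteq> 0\<close>, so there are finitely many such roots of
      unity.\<close>
    have "\<bar>D\<bar> * f v \<in> \<int>" using Df[OF f(2,3) v] by (auto simp: abs_if)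
    then have "cis (2 * pi * (\<bar>D\<bar> * f v)) = 1" by (simp only: cis_2pi_eq_1_iff)
    then show ?thesis by (simp add: f(1)[OF v] DeMoivre d mult_ac)
  qed
  then have "mult_harmonic G s \<subseteq> pverts G \<rightarrow>\<^sub>E {z. z ^ nat \<bar>d\<bar> = 1}"
    by (auto simp: mult_harmonic_iff PiE_iff extensional_def)
  moreover have "finite (pverts G \<rightarrow>\<^sub>E {z::complex. z ^ nat \<bar>d\<bar> = 1})"
    using \<open>d \<noteq> 0\<close> pair_finite_verts by (intro finite_PiE finite_roots_unity) auto
  ultimately show ?thesis by (rule finite_subset)
qed

section \<open>Spectral gaps\<close>

abbreviation nontrivial :: "('a \<Rightarrow> complex) \<Rightarrow> bool" where
  "nontrivial h \<equiv> h \<in> mult_harmonic G s \<and> (\<exists>v\<in>pverts G. h v \<noteq> 1)"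

lemma vec_l2_full: "(vec_l2 (vec_of n f))\<^sup>2 = (\<Sum>v\<in>pverts G. (f v)\<^sup>2)"
  by (simp add: vec_l2_def L2_set_def sum_verts sum_nonneg)

lemma vec_l2_reduced: "f s = 0 \<Longrightarrow> (vec_l2 (vec_of (n - 1) f))\<^sup>2 = (\<Sum>v\<in>pverts G. (f v)\<^sup>2)"
  by (simp add: vec_l2_def L2_set_def sum_verts_sink sum_nonneg)

lemma chain_eigenvalue_eq: "chain_eigenvalue G h = (\<Sum>v\<in>pverts G. h v) / of_nat n"
  by (simp add: chain_eigenvalue_def card_verts)

lemma one_minus_mean_cos:
  assumes "Re z = (\<Sum>v\<in>pverts G. cos (2 * pi * f v)) / real n"
  shows "1 - Re z = (\<Sum>v\<in>pverts G. 1 - cos (2 * pi * f v)) / real n"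
  using assms n_pos by (simp add: sum_subtractf card_verts diff_divide_distrib)

lemma mean_cos_le:
  assumes "Re z = (\<Sum>v\<in>pverts G. cos (2 * pi * f v)) / real n"
  shows "1 - Re z \<le> 2 * pi\<^sup>2 * ((\<Sum>v\<in>pverts G. (f v)\<^sup>2) / real n)"
proof -
  have "(\<Sum>v\<in>pverts G. 1 - cos (2 * pi * f v)) \<le> (\<Sum>v\<in>pverts G. 2 * pi\<^sup>2 * (f v)\<^sup>2)"
    by (intro sum_mono one_minus_cos_le)
  then show ?thesis
    unfolding one_minus_mean_cos[OF assms] by (simp add: sum_distrib_left divide_right_mono)
qed

lemma mean_cos_ge:
  assumes "Re z = (\<Sum>v\<in>pverts G. cos (2 * pi * f v)) / real n"
    and "\<And>v. v \<in> pverts G \<Longrightarrow> \<bar>f v\<bar> \<le> 1 / 2"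
  shows "8 * ((\<Sum>v\<in>pverts G. (f v)\<^sup>2) / real n) \<le> 1 - Re z"
proof -
  have "(\<Sum>v\<in>pverts G. 8 * (f v)\<^sup>2) \<le> (\<Sum>v\<in>pverts G. 1 - cos (2 * pi * f v))"
    using assms(2) by (intro sum_mono one_minus_cos_ge)
  then show ?thesis
    unfolding one_minus_mean_cos[OF assms(1)] by (simp add: sum_distrib_left divide_right_mono)
qed

text \<open>The phases of \<open>h\<close> with sink value 0 form the candidate: nontriviality of
  \<open>h\<close> gives a nonintegral phase, and their range permits the quadratic lower
  bound.\<close>

lemma continuous_lower:
  assumes h: "nontrivial h"
  shows "\<exists>y\<in>reduced_candidates G vs. 8 * ((vec_l2 y)\<^sup>2 / real n) \<le> 1 - Re (chain_eigenvalue G h)"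
proof -
  obtain f where f: "\<And>v. v \<in> pverts G \<Longrightarrow> \<bar>f v\<bar> \<le> 1 / 2"
    "\<And>v. v \<in> pverts G \<Longrightarrow> h v = cis (2 * pi * f v)"
    "\<And>v. v \<in> pverts G \<Longrightarrow> lap f v \<in> \<int>" "f s = 0"
    using h mult_harmonic_repr by metis
  have "\<exists>v\<in>pverts G. f v \<notin> \<int>" using h f(2) by (auto simp: cis_2pi_eq_1_iff)
  then have "vec_of (n - 1) f \<in> reduced_candidates G vs"
    unfolding reduced_candidates_iff using f by blast
  moreover have "Re (chain_eigenvalue G h) = (\<Sum>v\<in>pverts G. cos (2 * pi * f v)) / real n"
    by (simp add: chain_eigenvalue_eq f(2))
  then have "8 * ((vec_l2 (vec_of (n - 1) f))\<^sup>2 / real n) \<le> 1 - Re (chain_eigenvalue G h)"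
    unfolding vec_l2_reduced[of f, OF f(4)] using f(1) by (rule mean_cos_ge)
  ultimately show ?thesis by blast
qed

text \<open>Exponentiating a candidate gives the harmonic function; the quadratic upper bound holds
  for phases of any size.\<close>

lemma continuous_upper:
  assumes "y \<in> reduced_candidates G vs"
  shows "\<exists>h. nontrivial h \<and> 1 - Re (chain_eigenvalue G h) \<le> 2 * pi\<^sup>2 * ((vec_l2 y)\<^sup>2 / real n)"
proof -
  obtain f where f: "f s = 0" "\<And>v. v \<in> pverts G \<Longrightarrow> lap f v \<in> \<int>" "\<exists>v\<in>pverts G. f v \<notin> \<int>"
    "y = vec_of (n - 1) f"
    using assms unfolding reduced_candidates_iff by blast
  define h where "h = restrict (\<lambda>v. cis (2 * pi * f v)) (pverts G)"
  have "h \<in> mult_harmonic G s" unfolding h_def using f by (intro cis_mult_harmonic) auto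
  moreover have "\<exists>v\<in>pverts G. h v \<noteq> 1" using f(3) by (auto simp: h_def cis_2pi_eq_1_iff)
  moreover have "Re (chain_eigenvalue G h) = (\<Sum>v\<in>pverts G. cos (2 * pi * f v)) / real n"
    by (simp add: chain_eigenvalue_eq h_def)
  then have "1 - Re (chain_eigenvalue G h) \<le> 2 * pi\<^sup>2 * ((vec_l2 y)\<^sup>2 / real n)"
    unfolding f(4) vec_l2_reduced[of f, OF f(1)] by (rule mean_cos_le)
  ultimately show ?thesis by blast
qed

(* Rotating h so that its eigenvalue becomes |lambda| turns the modulus into a mean of cosines;
   centering the logarithm of the rotated function lands in the image of the pseudoinverse. *)
lemma discrete_lower:
  assumes h: "nontrivial h"
  shows "\<exists>z\<in>full_candidates G vs. 8 * ((vec_l2 z)\<^sup>2 / real n) \<le> 1 - cmod (chain_eigenvalue G h)"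
proof -
  define r where "r = cis (- Arg (chain_eigenvalue G h))"
  have r: "r * chain_eigenvalue G h = of_real (cmod (chain_eigenvalue G h))"
  proof -
    have "r * chain_eigenvalue G h
        = r * (of_real (cmod (chain_eigenvalue G h)) * cis (Arg (chain_eigenvalue G h)))"
      using rcis_cmod_Arg[of "chain_eigenvalue G h"] by (simp add: rcis_def)
    also have "\<dots> = of_real (cmod (chain_eigenvalue G h)) * (r * cis (Arg (chain_eigenvalue G h)))"
      by (simp only: mult_ac)
    also have "\<dots> = of_real (cmod (chain_eigenvalue G h))"
      by (simp add: r_def cis_mult)
    finally show ?thesis .
  qed
  obtain u where u: "\<And>v. v \<in> pverts G \<Longrightarrow> \<bar>u v\<bar> \<le> 1 / 2"
    "\<And>v. v \<in> pverts G \<Longrightarrow> cis (2 * pi * u v) = r * h v"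
    "\<And>v. v \<in> pverts G \<Longrightarrow> lap u v \<in> \<int>"
    using rotated_mult_harmonic_repr[of h r] h by (auto simp: r_def)
  define c where "c = (\<Sum>v\<in>pverts G. u v) / real n"
  define f where "f v = u v - c" for v
  have "(\<Sum>v\<in>pverts G. f v) = 0"
    using n_pos by (simp add: f_def sum_subtractf card_verts c_def)
  moreover have "\<forall>v\<in>pverts G. lap f v \<in> \<int>" using u(3) lap_shift[of u c] by (simp add: f_def[abs_def])
  moreover have "\<not> (\<exists>c. \<forall>v\<in>pverts G. f v - c \<in> \<int>)"
  proof
    assume "\<exists>c. \<forall>v\<in>pverts G. f v - c \<in> \<int>"
    then obtain c' where c': "\<forall>v\<in>pverts G. f v - c' \<in> \<int>" by blast
    have "h v = 1" if v: "v \<in> pverts G" for v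
    proof -
      \<comment> \<open>Both constants cancel in differences with the sink, so \<open>r * h\<close>
        is constant, and \<open>h s = 1\<close> makes \<open>h\<close> trivial.\<close>
      have "u v - u s = (f v - c') - (f s - c')" by (simp add: f_def)
      then have "u v - u s \<in> \<int>" using c' v s_in by (metis Ints_diff)
      then have "cis (2 * pi * (u v - u s)) = 1" by (simp only: cis_2pi_eq_1_iff)
      then have "cis (2 * pi * u v) = cis (2 * pi * u s)"
        by (simp add: right_diff_distrib cis_divide[symmetric])
      then have "r * h v = r * h s" using u(2) v s_in by simp
      then show ?thesis using h by (simp add: r_def mult_harmonic_iff)
    qed
    then show False using h by blast
  qed
  ultimately have "vec_of n f \<in> full_candidates G vs"
    unfolding full_candidates_iff by blast
  moreover have "8 * ((vec_l2 (vec_of n f))\<^sup>2 / real n) \<le> 1 - cmod (chain_eigenvalue G h)"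
  proof -
    have "r * chain_eigenvalue G h = (\<Sum>v\<in>pverts G. cis (2 * pi * u v)) / of_nat n"
      by (simp add: chain_eigenvalue_eq u(2) sum_distrib_left)
    then have "Re (r * chain_eigenvalue G h) = (\<Sum>v\<in>pverts G. cos (2 * pi * u v)) / real n" by simp
    then have "8 * ((\<Sum>v\<in>pverts G. (u v)\<^sup>2) / real n) \<le> 1 - Re (r * chain_eigenvalue G h)"
      using u(1) by (rule mean_cos_ge)
    \<comment> \<open>The cosine bound is applied to \<open>u\<close>, whose values have absolute
      value at most 1/2; centering, which may leave that range, then only shrinks the squared
      length.\<close>
    moreover have "(vec_l2 (vec_of n f))\<^sup>2 \<le> (\<Sum>v\<in>pverts G. (u v)\<^sup>2)"
    proof -
      have "(\<Sum>v\<in>pverts G. (u v - c)\<^sup>2) \<le> (\<Sum>v\<in>pverts G. (u v)\<^sup>2)"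
        using n_pos pair_finite_verts by (intro sum_sq_centered_le) (auto simp: c_def card_verts)
      then show ?thesis unfolding vec_l2_full[of f] by (simp add: f_def)
    qed
    then have "8 * ((vec_l2 (vec_of n f))\<^sup>2 / real n) \<le> 8 * ((\<Sum>v\<in>pverts G. (u v)\<^sup>2) / real n)"
      by (intro mult_left_mono divide_right_mono) auto
    ultimately show ?thesis by (simp add: r)
  qed
  ultimately show ?thesis by blast
qed

text \<open>Subtracting \<open>f s\<close> normalizes the exponential at the sink. Rotating its
  eigenvalue back by \<open>cis (2 * pi * f s)\<close> keeps the modulus, which dominates the real
  part, a mean of cosines of \<open>f\<close>.\<close>

lemma discrete_upper:
  assumes "z \<in> full_candidates G vs"
  shows "\<exists>h. nontrivial h \<and> 1 - cmod (chain_eigenvalue G h) \<le> 2 * pi\<^sup>2 * ((vec_l2 z)\<^sup>2 / real n)"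
proof -
  obtain f where f: "\<And>v. v \<in> pverts G \<Longrightarrow> lap f v \<in> \<int>" "\<not> (\<exists>c. \<forall>v\<in>pverts G. f v - c \<in> \<int>)"
    "z = vec_of n f"
    using assms unfolding full_candidates_iff by blast
  define h where "h = restrict (\<lambda>v. cis (2 * pi * (f v - f s))) (pverts G)"
  have "h \<in> mult_harmonic G s" unfolding h_def using f(1) by (intro cis_mult_harmonic) (auto simp: lap_shift)
  moreover have "\<exists>v\<in>pverts G. h v \<noteq> 1" using f(2) by (auto simp: h_def cis_2pi_eq_1_iff)
  moreover have "1 - cmod (chain_eigenvalue G h) \<le> 2 * pi\<^sup>2 * ((vec_l2 z)\<^sup>2 / real n)"
  proof -
    let ?\<mu> = "cis (2 * pi * f s) * chain_eigenvalue G h"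
    have "?\<mu> = (\<Sum>v\<in>pverts G. cis (2 * pi * f v)) / of_nat n"
      by (simp add: chain_eigenvalue_eq h_def sum_distrib_left cis_mult algebra_simps)
    then have "Re ?\<mu> = (\<Sum>v\<in>pverts G. cos (2 * pi * f v)) / real n" by simp
    then have "1 - Re ?\<mu> \<le> 2 * pi\<^sup>2 * ((vec_l2 z)\<^sup>2 / real n)"
      unfolding f(3) vec_l2_full by (rule mean_cos_le)
    moreover have "Re ?\<mu> \<le> cmod (chain_eigenvalue G h)"
      using complex_Re_le_cmod[of ?\<mu>] by (simp add: norm_mult)
    ultimately show ?thesis by linarith
  qed
  ultimately show ?thesis by blast
qed

text \<open>Shared by both gaps: for the lower bound, each harmonic function yields a candidate at
  least as long as the shortest one; for the upper bound, the shortest candidate itself yields a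
  harmonic function.\<close>

lemma gap_bounds:
  assumes lower: "\<And>h. nontrivial h \<Longrightarrow> \<exists>y\<in>C. 8 * ((vec_l2 y)\<^sup>2 / real n) \<le> F h"
    and upper: "\<And>y. y \<in> C \<Longrightarrow> \<exists>h. nontrivial h \<and> F h \<le> 2 * pi\<^sup>2 * ((vec_l2 y)\<^sup>2 / real n)"
    and y: "is_arg_min vec_l2 (\<lambda>x. x \<in> C) y"
  shows "8 * ((vec_l2 y)\<^sup>2 / real n) \<le> Min {F h | h. nontrivial h} \<and>
    Min {F h | h. nontrivial h} \<le> 2 * pi\<^sup>2 * ((vec_l2 y)\<^sup>2 / real n)"
proof -
  have yC: "y \<in> C" and min: "\<And>x. x \<in> C \<Longrightarrow> vec_l2 y \<le> vec_l2 x"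
    using y by (auto simp: is_arg_min_def not_less)
  have "{F h | h. nontrivial h} \<subseteq> F ` mult_harmonic G s" by auto
  then have fin: "finite {F h | h. nontrivial h}"
    by (rule finite_subset) (intro finite_imageI finite_mult_harmonic)
  \<comment> \<open>The candidate \<open>y\<close> also shows that the set of values is nonempty,
    so, being finite, it attains its \<open>Min\<close>.\<close>
  obtain h where h: "nontrivial h" "F h \<le> 2 * pi\<^sup>2 * ((vec_l2 y)\<^sup>2 / real n)"
    using upper[OF yC] by blast
  have "8 * ((vec_l2 y)\<^sup>2 / real n) \<le> F g" if g: "nontrivial g" for g
  proof -
    obtain x where x: "x \<in> C" "8 * ((vec_l2 x)\<^sup>2 / real n) \<le> F g" using lower[OF g] by blast
    have "(vec_l2 y)\<^sup>2 \<le> (vec_l2 x)\<^sup>2"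
      using min[OF x(1)] by (intro power_mono) (auto simp: vec_l2_def)
    then have "8 * ((vec_l2 y)\<^sup>2 / real n) \<le> 8 * ((vec_l2 x)\<^sup>2 / real n)"
      by (intro mult_left_mono divide_right_mono) auto
    with x(2) show ?thesis by linarith
  qed
  moreover have "Min {F h | h. nontrivial h} \<in> {F h | h. nontrivial h}"
    using fin h(1) by (intro Min_in) auto
  moreover have "Min {F h | h. nontrivial h} \<le> F h"
    using fin h(1) by (intro Min_le) auto
  ultimately show ?thesis using h(2) by (smt (verit) mem_Collect_eq)
qed

end

theorem theorem1p1:
  fixes G :: "'a pair_pre_digraph" and vs :: "'a list" and n :: nat and s :: 'a
  assumes "pair_graph G"
    and "Digraph_Component.connected (with_proj G)"
    and "\<not> undirected_tree G"
    and "distinct vs" and "set vs = pverts G" and "length vs = n"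
    and "s = last vs"
  shows "(\<forall>y. is_arg_min vec_l2 (\<lambda>x. x \<in> reduced_candidates G vs) y \<longrightarrow>
            8 * ((vec_l2 y)\<^sup>2 / real n) \<le> gap_continuous G s \<and>
            gap_continuous G s \<le> 2 * pi\<^sup>2 * ((vec_l2 y)\<^sup>2 / real n)) \<and>
         (\<forall>z. is_arg_min vec_l2 (\<lambda>x. x \<in> full_candidates G vs) z \<longrightarrow>
            8 * ((vec_l2 z)\<^sup>2 / real n) \<le> gap_discrete G s \<and>
            gap_discrete G s \<le> 2 * pi\<^sup>2 * ((vec_l2 z)\<^sup>2 / real n))"
proof -
  interpret connected_graph G vs
    using assms by (intro connected_graph.intro connected_graph_axioms.intro)
  have "n = length vs" "s = last vs" using assms by auto
  then show ?thesis
    unfolding gap_continuous_def gap_discrete_def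
    using gap_bounds[OF continuous_lower continuous_upper]
      gap_bounds[OF discrete_lower discrete_upper]
    by blast
qed

end
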